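(* Let $m\ge 0$ be an integer and let $j$ be an even integer with $0\le j\le 2m$. Then the sum of squares of column $j/2$ of the symmetric Krawtchouk matrix $\Phi^{m}$ is $(-1)^{j/2}\,\Phi^{2m}_{m\,j}$, i.e. $$\sum_{i=0}^m \left(\Phi^{m}_{i\;j/2}\right)^2=(-1)^{j/2}\,\Phi^{2m}_{m\;j}.$$
   Context: For an integer $N\ge 0$ and an integer $0\le j\le N$, the symmetric Krawtchouk values $\Phi^{N}_{n\,j}$ ($n$ = row index, $j$ = column index, both starting at $0$) are defined by $$(1+z)^{N-j}(1-z)^j=\sum_{n=0}^N z^n\,\Phi^{N}_{n\,j}.$$ *)

theory Defs
  imports "HOL-Computational_Algebra.Polynomial"
begin

(* krawtchouk N n j is the entry in row n and column j. It is meant for j \<le> N only: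
   for j > N the truncated subtraction N - j makes the value meaningless. *)
definition krawtchouk :: "nat \<Rightarrow> nat \<Rightarrow> nat \<Rightarrow> int" where
  "krawtchouk N n j = coeff ([:1, 1:] ^ (N - j) * [:1, - 1:] ^ j) n"

lemma krawtchouk_generating_function:
  fixes z :: int
  assumes "j \<le> N"
  shows "(1 + z) ^ (N - j) * (1 - z) ^ j = (\<Sum>n=0..N. z ^ n * krawtchouk N n j)"
proof -
  let ?p = "[:1, 1:] ^ (N - j) * [:1, - 1:] ^ j :: int poly"
  have "degree ?p \<le> (N - j) + j"
    by (rule order_trans[OF degree_mult_le])
      (intro add_mono order_trans[OF degree_power_le], auto)
  then have deg: "degree ?p \<le> N"
    using assms by simp
  have "poly ?p z = (\<Sum>n\<le>N. coeff ?p n * z ^ n)"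
    unfolding poly_altdef using deg
    by (intro sum.mono_neutral_left) (auto simp: coeff_eq_0)
  then show ?thesis
    by (simp add: krawtchouk_def atLeast0AtMost mult.commute)
qed

end

(* The polynomial p = (1 + z)^(m - k) (1 - z)^k with k = j/2 is palindromic up to the sign (-1)^k, so up to
   that sign its sum of squared coefficients is the middle coefficient of p^2 = (1 + z)^(2m - j) (1 - z)^j. *)
theory Submission
  imports Defs
begin

text \<open>Reversing coefficients is multiplicative; it fixes \<open>1 + z\<close> and negates
  \<open>1 - z\<close>, so each of the \<open>k\<close> factors \<open>1 - z\<close> contributes a
  sign.\<close>

lemma krawtchouk_symmetric:
  assumes "k \<le> N" and "i \<le> N"
  shows "krawtchouk N (N - i) k = (- 1) ^ k * krawtchouk N i k"
proof -
  define p :: "int poly" where "p = [:1, 1:] ^ (N - k) * [:1, - 1:] ^ k"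
  \<comment> \<open>Equality, not just a bound: \<open>reflect_poly\<close> reverses about the
    actual degree, so only then does index \<open>i\<close> go to \<open>N - i\<close>.\<close>
  have deg: "degree p = N"
    using assms(1) by (simp add: p_def degree_mult_eq degree_power_eq)
  have "reflect_poly p = [:1, 1:] ^ (N - k) * (- [:1, - 1:]) ^ k"
    by (simp add: p_def reflect_poly_mult reflect_poly_power reflect_poly_pCons)
  also have "\<dots> = (- 1) ^ k * p"
    by (simp only: p_def power_minus [of "[:1, - 1:]"] mult.left_commute)
  \<comment> \<open>The sign is so far a constant polynomial; as a scalar it passes through
    \<open>coeff\<close>.\<close>
  also have "\<dots> = smult ((- 1) ^ k) p"
    by (cases "even k") simp_all
  finally have "coeff (reflect_poly p) i = (- 1) ^ k * coeff p i"
    by simp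
  then show ?thesis
    using assms(2) deg by (simp add: coeff_reflect_poly krawtchouk_def p_def)
qed

theorem mainTheorem4:
  fixes m j :: nat
  assumes "even j" and "j \<le> 2 * m"
  shows "(\<Sum>i=0..m. (krawtchouk m i (j div 2)) ^ 2)
         = (- 1) ^ (j div 2) * krawtchouk (2 * m) m j"
proof -
  define k where "k = j div 2"
  have j: "j = 2 * k" and k: "k \<le> m"
    using assms by (auto simp: k_def)
  define p :: "int poly" where "p = [:1, 1:] ^ (m - k) * [:1, - 1:] ^ k"
  have "[:1, 1:] ^ (2 * m - j) * [:1, - 1:] ^ j = p * p"
  proof -
    have "2 * m - j = (m - k) + (m - k)" and "j = k + k"
      using j by simp_all
    then show ?thesis
      by (simp only: p_def power_add ac_simps)
  qed
  then have "krawtchouk (2 * m) m j = (\<Sum>i\<le>m. krawtchouk m i k * krawtchouk m (m - i) k)"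
    by (simp add: krawtchouk_def coeff_mult p_def)
  \<comment> \<open>At the middle index \<open>m\<close> the Cauchy product pairs mirror-image
    entries, which agree up to sign.\<close>
  also have "\<dots> = (\<Sum>i\<le>m. (- 1) ^ k * krawtchouk m i k ^ 2)"
    using k by (intro sum.cong) (simp_all add: krawtchouk_symmetric power2_eq_square)
  finally have "krawtchouk (2 * m) m j = (- 1) ^ k * (\<Sum>i=0..m. krawtchouk m i k ^ 2)"
    by (simp add: sum_distrib_left atLeast0AtMost)
  then show ?thesis
    \<comment> \<open>The two signs merge into \<open>((- 1) * (- 1)) ^ k = 1\<close>.\<close>
    by (simp add: k_def flip: mult.assoc power_mult_distrib)
qed

end
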